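(* Let $c\in(0,1]$ be a constant and let $\sigma,N\ge2$ be integers. Call an integer $m\ge2$ admissible if, for $\ell:=\lfloor c\log_\sigma m\rfloor$, it holds $\ell\ge1$ and $m\ell\le N$, and assume that an admissible $m$ exists. Any data structure supporting prefix special rank queries for every admissible $m$ and every sequence $W[1..m]$ of $m$ strings over alphabet $[0..\sigma)$, each of length exactly $\ell=\lfloor c\log_\sigma m\rfloor$, has worst-case space usage $\Omega(N\log\sigma)$ bits (with the hidden constant depending on at most $c$).
   Context: Here $[0..\sigma)=\{0,\dots,\sigma-1\}$ and $\log$ without a base is base 2. For a sequence $W[1..m]$ of strings of length $\ell$, $i\in\{1,\dots,m\}$ and $p\in\{0,\dots,\ell\}$, the prefix special rank query returns $\mathsf{prefix\text{-}special\text{-}rank}_W(i,p)=|\{j\in\{1,\dots,i\}:W[i][1..p]\text{ is a prefix of }W[j]\}|$. A data structure supporting a query problem for a family of inputs (with parameters $c,\sigma,N$ fixed) assigns to each input a finite bit string; the answer to every query on an input is determined by the stored bit string and the query arguments only. The space used on an input is the length of its bit string, and the worst-case space usage is the maximum over all inputs in the family. Query time is irrelevant. *)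

theory Defs
  imports Complex_Main "HOL-Library.Sublist"
begin

definition string_length :: "real \<Rightarrow> nat \<Rightarrow> nat \<Rightarrow> nat" where
  "string_length c \<sigma> m = nat \<lfloor>c * log (real \<sigma>) (real m)\<rfloor>"

definition admissible :: "real \<Rightarrow> nat \<Rightarrow> nat \<Rightarrow> nat \<Rightarrow> bool" where
  "admissible c \<sigma> N m \<longleftrightarrow>
     m \<ge> 2 \<and> string_length c \<sigma> m \<ge> 1 \<and> m * string_length c \<sigma> m \<le> N"

text \<open>Sequences are lists of strings, so \<open>length W\<close> is the number $m$ of strings.
  The family contains the sequences for all admissible $m$ at once.\<close>

definition psr_inputs :: "real \<Rightarrow> nat \<Rightarrow> nat \<Rightarrow> nat list list set" where
  "psr_inputs c \<sigma> N =
     {W. admissible c \<sigma> N (length W) \<and>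
         (\<forall>w\<in>set W. length w = string_length c \<sigma> (length W) \<and> set w \<subseteq> {0..<\<sigma>})}"

text \<open>Positions \<open>i\<close>, \<open>j\<close> are 1-based, while list indexing is 0-based.\<close>

definition prefix_special_rank :: "'a list list \<Rightarrow> nat \<Rightarrow> nat \<Rightarrow> nat" where
  "prefix_special_rank W i p = card {j \<in> {1..i}. prefix (take p (W ! (i - 1))) (W ! (j - 1))}"

text \<open>A data structure is given by its encoding \<open>D\<close> of inputs as bit strings. The query
  algorithm \<open>ans\<close> sees the stored bit string and the query arguments, but neither \<open>W\<close> nor
  its length; as it is chosen after \<open>c\<close>, \<open>\<sigma>\<close> and \<open>N\<close>, it may depend on these.\<close>

definition supports_prefix_special_rank ::
    "real \<Rightarrow> nat \<Rightarrow> nat \<Rightarrow> (nat list list \<Rightarrow> bool list) \<Rightarrow> bool" where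
  "supports_prefix_special_rank c \<sigma> N D \<longleftrightarrow>
     (\<exists>ans :: bool list \<Rightarrow> nat \<Rightarrow> nat \<Rightarrow> nat.
        \<forall>W \<in> psr_inputs c \<sigma> N. \<forall>i \<in> {1..length W}. \<forall>p \<in> {0..string_length c \<sigma> (length W)}.
          ans (D W) i p = prefix_special_rank W i p)"

definition worst_case_space ::
    "real \<Rightarrow> nat \<Rightarrow> nat \<Rightarrow> (nat list list \<Rightarrow> bool list) \<Rightarrow> nat" where
  "worst_case_space c \<sigma> N D = Max ((\<lambda>W. length (D W)) ` psr_inputs c \<sigma> N)"

text \<open>The maximum is taken over a finite set, which is nonempty if there is an admissible $m$.\<close>

lemma finite_psr_inputs: "finite (psr_inputs c \<sigma> N)"
proof -
  have bound: "m \<le> N \<and> string_length c \<sigma> m \<le> N" if "admissible c \<sigma> N m" for m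
  proof -
    have "m * 1 \<le> m * string_length c \<sigma> m"
      and "1 * string_length c \<sigma> m \<le> m * string_length c \<sigma> m"
      using that unfolding admissible_def by (intro mult_le_mono; simp)+
    then show ?thesis
      using that unfolding admissible_def by linarith
  qed
  let ?S = "{w. set w \<subseteq> {0..<\<sigma>} \<and> length w \<le> N}"
  have "finite ?S"
    by (rule finite_lists_length_le) simp
  then have "finite {W. set W \<subseteq> ?S \<and> length W \<le> N}"
    by (rule finite_lists_length_le)
  moreover have "psr_inputs c \<sigma> N \<subseteq> {W. set W \<subseteq> ?S \<and> length W \<le> N}"
    using bound unfolding psr_inputs_def by auto
  ultimately show ?thesis
    by (rule rev_finite_subset)
qed

lemma psr_inputs_nonempty:
  assumes "\<sigma> \<ge> 2" and "admissible c \<sigma> N m"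
  shows "psr_inputs c \<sigma> N \<noteq> {}"
proof -
  have "replicate m (replicate (string_length c \<sigma> m) 0) \<in> psr_inputs c \<sigma> N"
    using assms unfolding psr_inputs_def by auto
  then show ?thesis
    by blast
qed

end

theory Submission
  imports Defs "HOL-Combinatorics.Multiset_Permutations"
begin

text \<open>Only queries with \<open>p = \<ell>\<close> are needed: they return, for each position of a word over
  $\sigma^\ell$ symbols, the number of occurrences so far of the symbol at that position. Start with
  a word in which $A$ symbols have pairwise different numbers of occurrences, and append $t$
  permutations of these symbols. Each permutation raises all the counts by one, so they stay
  different, and the rank at a position reveals the symbol there. This gives $(A!)^t$
  inputs that need different encodings. With $A = \lfloor m^{c/2}\rfloor$, we have $A^2 \le m$ and
  $A \le \sigma^\ell$, and the logarithm of $(A!)^t$ is $\Omega(m \log m)$,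
  unless $m^{c/2} < 2$; then $m$ is bounded and a single bit is enough. If $m$ is the largest admissible
  number, then $m + 1$ is not admissible, which gives $N \log \sigma = O(m \log m)$.\<close>

section \<open>Words determined by their occurrence ranks\<close>

definition occurrence_rank :: "'a list \<Rightarrow> nat \<Rightarrow> nat" where
  "occurrence_rank u i = count_list (take (Suc i) u) (u ! i)"

lemma count_list_distinct: "distinct xs \<Longrightarrow> count_list xs x = (if x \<in> set xs then 1 else 0)"
  by (induction xs) auto

text \<open>The only occurrence inside the block is the one at position \<open>k\<close>, so the
  rank depends on the block through the symbol \<open>xs ! k\<close> alone.\<close>

lemma occurrence_rank_append_distinct:
  assumes "distinct xs" "k < length xs"
  shows "occurrence_rank (p @ xs @ z) (length p + k) = Suc (count_list p (xs ! k))"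
proof -
  have "take (Suc (length p + k)) (p @ xs @ z) = p @ take (Suc k) xs"
    using assms by simp
  moreover have "(p @ xs @ z) ! (length p + k) = xs ! k"
    using assms by (simp add: nth_append)
  moreover have "xs ! k \<in> set (take (Suc k) xs)"
    using assms by (simp add: take_Suc_conv_app_nth)
  ultimately show ?thesis
    using assms by (simp add: occurrence_rank_def count_list_distinct)
qed

text \<open>Induction over the blocks with \<open>p\<close> arbitrary: a recovered block is moved
  into the known prefix \<open>p\<close>, where the counts on \<open>S\<close> are still pairwise
  different.\<close>

lemma occurrence_ranks_determine_permutations:
  assumes "inj_on (count_list p) S"
    and "set xss \<subseteq> permutations_of_set S" "set yss \<subseteq> permutations_of_set S"
    and "length xss = length yss"
    and "\<And>i. i < length (p @ concat xss @ z) \<Longrightarrow>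
      occurrence_rank (p @ concat xss @ z) i = occurrence_rank (p @ concat yss @ z) i"
  shows "xss = yss"
  using assms(4,1-3,5)
proof (induction xss yss arbitrary: p rule: list_induct2)
  case Nil
  then show ?case by simp
next
  case (Cons xs xss ys yss)
  have xs: "distinct xs" "set xs = S" and ys: "distinct ys" "set ys = S"
    using Cons.prems(2,3) by (auto simp: permutations_of_set_def)
  have len: "length xs = length ys"
    using xs ys by (metis distinct_card)
  have "xs = ys"
  proof (rule nth_equalityI[OF len])
    fix k assume k: "k < length xs"
    have "Suc (count_list p (xs ! k)) = Suc (count_list p (ys ! k))"
      using Cons.prems(4)[of "length p + k"] k len
        occurrence_rank_append_distinct[OF xs(1) k, of p "concat xss @ z"]
        occurrence_rank_append_distinct[OF ys(1), of k p "concat yss @ z"]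
      by simp
    moreover have "xs ! k \<in> S" "ys ! k \<in> S"
      using k len xs(2) ys(2) nth_mem by metis+
    ultimately show "xs ! k = ys ! k"
      using Cons.prems(1) by (auto dest: inj_onD)
  qed
  moreover have "xss = yss"
  proof (rule Cons.IH)
    have "count_list (p @ xs) x = Suc (count_list p x)" if "x \<in> S" for x
      using that xs by (simp add: count_list_distinct)
    then show "inj_on (count_list (p @ xs)) S"
      using Cons.prems(1) by (simp add: inj_on_def)
    show "occurrence_rank ((p @ xs) @ concat xss @ z) i = occurrence_rank ((p @ xs) @ concat yss @ z) i"
      if "i < length ((p @ xs) @ concat xss @ z)" for i
      using Cons.prems(4)[of i] that \<open>xs = ys\<close> by simp
  qed (use Cons.prems(2,3) in auto)
  ultimately show ?case by simp
qed

text \<open>The counts 0, ..., A - 1 are the cheapest pairwise different ones: they take about half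
  of A^2 positions, so A * A \<le> m leaves room for permutations.\<close>

definition staircase_word :: "nat \<Rightarrow> nat list" where
  "staircase_word A = concat (map (\<lambda>s. replicate s s) [0..<A])"

lemma staircase_word_Suc: "staircase_word (Suc A) = staircase_word A @ replicate A A"
  by (simp add: staircase_word_def)

lemma count_list_replicate: "count_list (replicate n x) y = (if x = y then n else 0)"
  by (induction n) auto

lemma count_list_staircase_word: "count_list (staircase_word A) s = (if s < A then s else 0)"
proof (induction A)
  case (Suc A)
  then show ?case by (auto simp: staircase_word_Suc count_list_replicate)
qed (simp add: staircase_word_def)

lemma set_staircase_word: "set (staircase_word A) \<subseteq> {..<A}"
  by (auto simp: staircase_word_def)

text \<open>The length is 0 + 1 + ... + (A - 1), expressed without division or subtraction.\<close>

lemma length_staircase_word: "2 * length (staircase_word A) + A = A * A"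
  by (induction A) (simp_all add: staircase_word_Suc, simp add: staircase_word_def)

text \<open>Ranks see only equality of symbols. Numbers below A can therefore stand for strings over
  the alphabet.\<close>

lemma occurrence_rank_map:
  assumes "inj_on f (set u)" "i < length u"
  shows "occurrence_rank (map f u) i = occurrence_rank u i"
proof -
  have "count_list (map f xs) (f x) = count_list xs x" if "set xs \<subseteq> set u" "x \<in> set u" for xs x
    using that assms(1) by (induction xs) (auto dest: inj_onD)
  from this[of "take (Suc i) u" "u ! i"] assms(2) show ?thesis
    by (simp add: occurrence_rank_def take_map set_take_subset)
qed

section \<open>From prefix special rank queries to occurrence ranks\<close>

lemma card_eq_count_list: "card {j \<in> {1..n}. x = u ! (j - 1)} = count_list (take n u) x"
  if "n \<le> length u"
  using that
proof (induction n)
  case (Suc n)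
  have "{j \<in> {1..Suc n}. x = u ! (j - 1)} =
      (if x = u ! n then insert (Suc n) else id) {j \<in> {1..n}. x = u ! (j - 1)}"
    by (auto simp: le_Suc_eq)
  then show ?case
    using Suc by (simp add: take_Suc_conv_app_nth)
qed simp

text \<open>Among strings of the same length, a prefix is an equal string. \<open>Suc i\<close> is
  the 1-based form of the 0-based position \<open>i\<close>.\<close>

lemma prefix_special_rank_full_length:
  assumes "\<And>w. w \<in> set W \<Longrightarrow> length w = l" "i < length W"
  shows "prefix_special_rank W (Suc i) l = occurrence_rank W i"
proof -
  have "prefix (take l (W ! i)) (W ! (j - 1)) \<longleftrightarrow> W ! i = W ! (j - 1)"
    if "j \<in> {1..Suc i}" for j
  proof -
    have "length (W ! i) = l" "length (W ! (j - 1)) = l"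
      using that assms by auto
    then show ?thesis
      by (auto simp: prefix_def)
  qed
  then have "{j \<in> {1..Suc i}. prefix (take l (W ! i)) (W ! (j - 1))} =
      {j \<in> {1..Suc i}. W ! i = W ! (j - 1)}"
    by blast
  then show ?thesis
    using card_eq_count_list[of "Suc i" W "W ! i"] assms(2)
    by (simp add: prefix_special_rank_def occurrence_rank_def)
qed

text \<open>Equally long sequences have the same string length, so the query with arguments
  \<open>Suc i\<close> and \<open>?l\<close> is legal for both, and its answer depends only on the
  shared bit string.\<close>

lemma equal_encodings_equal_ranks:
  assumes "supports_prefix_special_rank c \<sigma> N D"
    and "V \<in> psr_inputs c \<sigma> N" "W \<in> psr_inputs c \<sigma> N"
    and "length V = length W" "D V = D W" "i < length W"
  shows "occurrence_rank V i = occurrence_rank W i"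
proof -
  let ?l = "string_length c \<sigma> (length W)"
  obtain ans where ans: "\<And>U j p. \<lbrakk>U \<in> psr_inputs c \<sigma> N; j \<in> {1..length U};
      p \<in> {0..string_length c \<sigma> (length U)}\<rbrakk> \<Longrightarrow> ans (D U) j p = prefix_special_rank U j p"
    using assms(1) unfolding supports_prefix_special_rank_def by metis
  have "occurrence_rank U i = ans (D U) (Suc i) ?l"
    if "U \<in> psr_inputs c \<sigma> N" "length U = length W" for U
  proof -
    have "prefix_special_rank U (Suc i) ?l = occurrence_rank U i"
      using that assms(6) by (intro prefix_special_rank_full_length) (auto simp: psr_inputs_def)
    then show ?thesis
      using ans[of U "Suc i" ?l] that assms(6) by simp
  qed
  then show ?thesis
    using assms(2-5) by simp
qed

section \<open>Counting bit strings and inputs\<close>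

lemma length_le_worst_case_space:
  "W \<in> psr_inputs c \<sigma> N \<Longrightarrow> length (D W) \<le> worst_case_space c \<sigma> N D"
  by (simp add: worst_case_space_def finite_psr_inputs)

text \<open>Encodings may have any length up to \<open>L\<close>, and there are 2^(L+1) - 1 such bit
  strings.\<close>

lemma card_inj_encoding:
  assumes "finite X" "inj_on E X" "\<And>x. x \<in> X \<Longrightarrow> length (E x :: bool list) \<le> L"
  shows "card X < 2 ^ Suc L"
proof -
  have "E ` X \<subseteq> {b. set b \<subseteq> UNIV \<and> length b \<le> L}"
    using assms(3) by auto
  then have "card (E ` X) \<le> card {b :: bool list. set b \<subseteq> UNIV \<and> length b \<le> L}"
    by (intro card_mono finite_lists_length_le) auto
  also have "\<dots> = (\<Sum>i\<le>L. 2 ^ i)"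
    by (subst card_lists_length_le) simp_all
  also have "\<dots> < 2 ^ Suc L"
    by (induction L) auto
  finally show ?thesis
    using assms(2) by (simp add: card_image)
qed

text \<open>This bound settles the case of bounded m and absorbs the additive 1 of the counting
  bound.\<close>

lemma worst_case_space_pos:
  assumes "\<sigma> \<ge> 2" "admissible c \<sigma> N m" "supports_prefix_special_rank c \<sigma> N D"
  shows "worst_case_space c \<sigma> N D \<ge> 1"
proof (rule ccontr)
  assume "\<not> ?thesis"
  then have D: "D U = []" if "U \<in> psr_inputs c \<sigma> N" for U
    using length_le_worst_case_space[OF that, of D] by (simp add: not_less_eq_eq)
  let ?l = "string_length c \<sigma> m"
  \<comment> \<open>Two inputs that differ in the last string only: its rank is \<open>m\<close> in
    \<open>V\<close> and 1 in \<open>W\<close>.\<close>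
  define V where "V = replicate m (replicate ?l (0::nat))"
  define W where "W = replicate (m - 1) (replicate ?l 0) @ [replicate ?l (1::nat)]"
  have m: "m \<ge> 2" "?l \<ge> 1"
    using assms(2) by (auto simp: admissible_def)
  have [simp]: "length V = m" "length W = m"
    using m by (simp_all add: V_def W_def)
  have "V \<in> psr_inputs c \<sigma> N" "W \<in> psr_inputs c \<sigma> N"
    using assms(1,2) m by (auto simp: psr_inputs_def) (auto simp: V_def W_def)
  then have "occurrence_rank V (m - 1) = occurrence_rank W (m - 1)"
    using m D by (intro equal_encodings_equal_ranks[OF assms(3)]) auto
  moreover have "occurrence_rank V (m - 1) = m"
    using m by (simp add: occurrence_rank_def V_def count_list_replicate)
  moreover have "occurrence_rank W (m - 1) = 1"
    using m by (simp add: occurrence_rank_def W_def count_list_replicate nth_append)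
  ultimately show False
    using m by simp
qed

lemma fact_power_lt_worst_case_space:
  assumes "admissible c \<sigma> N m" "supports_prefix_special_rank c \<sigma> N D"
    and "0 < A" "A \<le> \<sigma> ^ string_length c \<sigma> m"
    and "length (staircase_word A) + t * A \<le> m"
  shows "fact A ^ t < (2::nat) ^ Suc (worst_case_space c \<sigma> N D)"
proof -
  let ?l = "string_length c \<sigma> m" and ?P = "permutations_of_set {..<A}" and ?p = "staircase_word A"
  define X where "X = {xss. set xss \<subseteq> ?P \<and> length xss = t}"
  \<comment> \<open>Padding to exactly \<open>m\<close> symbols; 0 is one of the symbols in
    \<open>{..<A}\<close> because 0 < A.\<close>
  define z where "z = replicate (m - (length ?p + t * A)) (0::nat)"
  define word where "word xss = ?p @ concat xss @ z" for xss
  have "card {w. set w \<subseteq> {0..<\<sigma>} \<and> length w = ?l} = \<sigma> ^ ?l"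
    by (subst card_lists_length_eq) simp_all
  then have "\<exists>e. e ` {..<A} \<subseteq> {w. set w \<subseteq> {0..<\<sigma>} \<and> length w = ?l} \<and> inj_on e {..<A}"
    using assms(4) by (intro card_le_inj finite_lists_length_eq) simp_all
  then obtain e where e: "e ` {..<A} \<subseteq> {w. set w \<subseteq> {0..<\<sigma>} \<and> length w = ?l}" "inj_on e {..<A}"
    by blast
  have len: "length (word xss) = m" if "xss \<in> X" for xss
  proof -
    have "length xs = A" if "xs \<in> ?P" for xs
      using that distinct_card[of xs] by (simp add: permutations_of_set_def)
    then have "map length xss = replicate t A"
      using that by (intro replicate_eqI) (auto simp: X_def)
    then have "length (concat xss) = t * A"
      by (simp add: length_concat sum_list_replicate)
    then show ?thesis
      using assms(5) by (simp add: word_def z_def)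
  qed
  have set_word: "set (word xss) \<subseteq> {..<A}" if "xss \<in> X" for xss
    using that set_staircase_word[of A] assms(3)
    by (auto simp: word_def z_def X_def permutations_of_set_def)
  have inputs: "map e (word xss) \<in> psr_inputs c \<sigma> N" if "xss \<in> X" for xss
    using e(1) set_word[OF that] assms(1) len[OF that] by (auto simp: psr_inputs_def image_subset_iff subset_iff)
  have "inj_on (\<lambda>xss. D (map e (word xss))) X"
  proof (rule inj_onI)
    fix xss yss assume X: "xss \<in> X" "yss \<in> X" and eq: "D (map e (word xss)) = D (map e (word yss))"
    have "occurrence_rank (word xss) i = occurrence_rank (word yss) i" if "i < m" for i
    proof -
      have "occurrence_rank (map e (word xss)) i = occurrence_rank (map e (word yss)) i"
        using that X eq by (intro equal_encodings_equal_ranks[OF assms(2)]) (auto simp: inputs len)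
      moreover have "occurrence_rank (map e (word zss)) i = occurrence_rank (word zss) i"
        if "zss \<in> X" for zss
        using \<open>i < m\<close> inj_on_subset[OF e(2) set_word[OF that]] that
        by (intro occurrence_rank_map) (auto simp: len)
      ultimately show ?thesis
        using X by simp
    qed
    moreover have "inj_on (count_list ?p) {..<A}"
      by (auto simp: inj_on_def count_list_staircase_word)
    ultimately show "xss = yss"
      using X len[OF X(1)] 
      by (intro occurrence_ranks_determine_permutations[of ?p "{..<A}" xss yss z])
        (auto simp: X_def word_def)
  qed
  moreover have "finite X"
    unfolding X_def by (intro finite_lists_length_eq) simp
  ultimately have "card X < 2 ^ Suc (worst_case_space c \<sigma> N D)"
    by (intro card_inj_encoding) (auto intro: length_le_worst_case_space inputs)
  moreover have "card X = fact A ^ t"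
    unfolding X_def by (subst card_lists_length_eq) simp_all
  ultimately show ?thesis
    by simp
qed

section \<open>Factorial estimate and the space bound for one m\<close>

lemma power_self_le_fact_squared: "n ^ n \<le> (fact n :: nat) ^ 2"
proof -
  have "n ^ n = (\<Prod>k=1..n. n)"
    by simp
  \<comment> \<open>The square of the factorial pairs each factor \<open>k\<close> with
    \<open>n + 1 - k\<close>.\<close>
  also have "\<dots> \<le> (\<Prod>k=1..n. k * (n + 1 - k))"
  proof (rule prod_mono)
    fix k assume "k \<in> {1..n}"
    \<comment> \<open>The product of the pair is (a + 1) * (b + 1), which is at least a + b + 1 =
      n.\<close>
    then obtain a b where "k = Suc a" "n = Suc a + b"
      by (auto simp: le_iff_add)
    then show "0 \<le> n \<and> n \<le> k * (n + 1 - k)"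
      by simp
  qed
  also have "\<dots> = fact n * (\<Prod>k=1..n. n + 1 - k)"
    by (simp add: prod.distrib fact_prod)
  also have "(\<Prod>k=1..n. n + 1 - k) = fact n"
    unfolding fact_prod of_nat_id
    by (rule prod.reindex_bij_witness[of _ "\<lambda>k. n + 1 - k" "\<lambda>k. n + 1 - k"]) auto
  finally show ?thesis
    by (simp add: power2_eq_square)
qed

lemma log2_fact_ge: "n > 0 \<Longrightarrow> real n / 2 * log 2 n \<le> log 2 (fact n)"
proof -
  assume n: "n > 0"
  have "real (n ^ n) \<le> real (fact n ^ 2)"
    using power_self_le_fact_squared of_nat_le_iff by blast
  then have "real n ^ n \<le> fact n ^ 2"
    by simp
  then have "log 2 (real n ^ n) \<le> log 2 (fact n ^ 2)"
    using n by (subst log_le_cancel_iff) auto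
  then show ?thesis
    using n by (simp add: log_nat_power)
qed

lemma worst_case_space_ge:
  assumes "admissible c \<sigma> N m" "supports_prefix_special_rank c \<sigma> N D"
    and "\<sigma> \<ge> 2" "0 < A" "A \<le> \<sigma> ^ string_length c \<sigma> m" "A * A \<le> m"
  shows "real m * log 2 A \<le> 16 * worst_case_space c \<sigma> N D"
proof -
  let ?L = "worst_case_space c \<sigma> N D" and ?s = "length (staircase_word A)"
  \<comment> \<open>As many permutations as fit behind the staircase; fewer than \<open>A\<close>
    positions remain.\<close>
  define t where "t = (m - ?s) div A"
  have s: "2 * ?s + A = A * A"
    by (rule length_staircase_word)
  have div: "t * A + (m - ?s) mod A = m - ?s"
    by (simp add: t_def)
  have "(m - ?s) mod A < A"
    using assms(4) by simp
  \<comment> \<open>This is (A - 1)^2 \<ge> 0. Staircase and remainder together take less than (A^2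
    + A) / 2 positions, hence less than 3 * m / 4, and the permutations fill at least a quarter of
    \<open>m\<close>.\<close>
  moreover have "2 * A \<le> A * A + 1"
    using assms(4) by (cases A) auto
  ultimately have tA: "m \<le> 4 * (t * A)" and st: "?s + t * A \<le> m"
    using div s assms(6) by linarith+
  have "real m * log 2 A \<le> real (4 * (t * A)) * log 2 A"
    using assms(4) by (intro mult_right_mono of_nat_mono tA) simp
  also have "\<dots> = 8 * t * (real A / 2 * log 2 A)"
    by simp
  also have "\<dots> \<le> 8 * t * log 2 (fact A)"
    using log2_fact_ge[OF assms(4)] by (intro mult_left_mono) auto
  also have "\<dots> = 8 * log 2 (fact A ^ t)"
    by (simp add: log_nat_power)
  also have "\<dots> \<le> 8 * log 2 (2 ^ Suc ?L)"
  proof -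
    have "real (fact A ^ t) \<le> real (2 ^ Suc ?L)"
      using fact_power_lt_worst_case_space[OF assms(1,2,4,5) st]
      by (intro of_nat_mono less_imp_le)
    then have "fact A ^ t \<le> (2::real) ^ Suc ?L"
      by simp
    then show ?thesis
      by simp
  qed
  also have "\<dots> = 8 * (?L + 1)"
    by (simp add: log_nat_power del: power_Suc)
  \<comment> \<open>The extra 1 is absorbed because \<open>?L\<close> is at least 1.\<close>
  also have "\<dots> \<le> 16 * ?L"
    using worst_case_space_pos[OF assms(3,1,2)] by simp
  finally show ?thesis by simp
qed

section \<open>String lengths and the largest admissible m\<close>

lemma string_length_gt:
  assumes "\<sigma> \<ge> 2" "m \<ge> 2" "string_length c \<sigma> m \<ge> 1"
  shows "real m powr (c / 2) < real \<sigma> ^ string_length c \<sigma> m"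
proof -
  let ?l = "string_length c \<sigma> m"
  \<comment> \<open>Rounding down loses less than 1, and doubling a length of at least 1 makes up
    for this; hence the exponent c / 2.\<close>
  have "c * log \<sigma> m < real ?l + 1"
    using assms(3) unfolding string_length_def by linarith
  also have "\<dots> \<le> 2 * real ?l"
    using assms(3) by simp
  finally have "log \<sigma> (real m powr (c / 2)) < ?l"
    using assms(2) by (simp add: log_powr)
  also have "real ?l = log \<sigma> (real \<sigma> ^ ?l)"
    using assms(1) by (simp add: log_nat_power)
  finally show ?thesis
    using assms(1,2) by (subst (asm) log_less_cancel_iff) auto
qed

text \<open>With f the floor of x, x \<le> 2 * f \<le> f^2. Rounding down thus at most halves the
  logarithm.\<close>

lemma sqrt_le_floor:
  fixes x :: real
  assumes "x \<ge> 2"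
  shows "sqrt x \<le> \<lfloor>x\<rfloor>"
proof -
  have "x \<le> 2 * \<lfloor>x\<rfloor>" "2 \<le> \<lfloor>x\<rfloor>"
    using assms by linarith+
  then have "x \<le> of_int \<lfloor>x\<rfloor> * of_int \<lfloor>x\<rfloor>"
    using mult_right_mono[of 2 "real_of_int \<lfloor>x\<rfloor>" "real_of_int \<lfloor>x\<rfloor>"] by linarith
  then show ?thesis
    using assms by (intro real_le_lsqrt) (auto simp: power2_eq_square)
qed

text \<open>The witness is the largest admissible m. The factor 4 is the cost of replacing m + 1 by
  m, a factor 2 outside the logarithm and a factor 2 for the logarithm itself.\<close>

lemma largest_admissible:
  assumes "0 < c" "c \<le> 1" "\<sigma> \<ge> 2" "\<exists>m. admissible c \<sigma> N m"
  obtains m where "admissible c \<sigma> N m" "N * log 2 \<sigma> \<le> 4 * (m * log 2 m)"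
proof -
  have bound: "m \<le> N" if "admissible c \<sigma> N m" for m
  proof -
    have "m * 1 \<le> m * string_length c \<sigma> m"
      using that by (intro mult_le_mono) (auto simp: admissible_def)
    then show ?thesis
      using that unfolding admissible_def by linarith
  qed
  define m where "m = (GREATEST m. admissible c \<sigma> N m)"
  have adm: "admissible c \<sigma> N m"
    unfolding m_def using assms(4) bound by (rule GreatestI_ex_nat)
  have "k \<le> m" if "admissible c \<sigma> N k" for k
    unfolding m_def using that bound by (rule Greatest_le_nat)
  then have "\<not> admissible c \<sigma> N (Suc m)"
    using not_less_eq_eq by blast
  moreover have m: "m \<ge> 2" "string_length c \<sigma> m \<ge> 1"
    using adm by (auto simp: admissible_def)
  moreover have "log \<sigma> m \<le> log \<sigma> (Suc m)"
    using assms(3) m by simp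
  then have "string_length c \<sigma> m \<le> string_length c \<sigma> (Suc m)"
    using assms(1) unfolding string_length_def
    by (intro nat_mono floor_mono mult_left_mono) auto
  \<comment> \<open>The string length is monotone in m, so m + 1 can fail only the size
    condition.\<close>
  ultimately have "N \<le> Suc m * string_length c \<sigma> (Suc m)"
    by (auto simp: admissible_def)
  then have "real N \<le> real (Suc m) * real (string_length c \<sigma> (Suc m))"
    by (metis of_nat_le_iff of_nat_mult)
  also have "\<dots> \<le> real (Suc m) * log \<sigma> (Suc m)"
  proof (intro mult_left_mono)
    have "0 \<le> log \<sigma> (Suc m)"
      using assms(3) by simp
    then have "real (string_length c \<sigma> (Suc m)) \<le> c * log \<sigma> (Suc m)"
      using assms(1) unfolding string_length_def by simp
    also have "\<dots> \<le> log \<sigma> (Suc m)"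
      using assms(2) \<open>0 \<le> log \<sigma> (Suc m)\<close> by (simp add: mult_left_le_one_le assms(1) less_imp_le)
    finally show "real (string_length c \<sigma> (Suc m)) \<le> log \<sigma> (Suc m)" .
  qed simp
  finally have "N * log 2 \<sigma> \<le> real (Suc m) * log \<sigma> (Suc m) * log 2 \<sigma>"
    using assms(3) by (intro mult_right_mono) auto
  \<comment> \<open>The factor log 2 \<sigma> changes the base of the logarithm from \<sigma> to
    2.\<close>
  also have "\<dots> = real (Suc m) * log 2 (Suc m)"
    using assms(3) by (simp add: log_def)
  also have "\<dots> \<le> (2 * m) * (2 * log 2 m)"
  proof (intro mult_mono)
    have "Suc m \<le> m ^ 2"
      using m mult_le_mono1[of 2 m m] unfolding power2_eq_square by linarith
    then have "real (Suc m) \<le> real m ^ 2"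
      by (metis of_nat_le_iff of_nat_power)
    then have "log 2 (Suc m) \<le> log 2 (real m ^ 2)"
      by (subst log_le_cancel_iff) (use m in auto)
    then show "log 2 (Suc m) \<le> 2 * log 2 m"
      using m by (simp add: log_nat_power)
  qed (use m in auto)
  finally show thesis
    using adm by (intro that) auto
qed

section \<open>The final bound, by cases on the size of m\<close>

theorem corollary5p25:
  fixes c :: real
  assumes "0 < c" and "c \<le> 1"
  shows "\<exists>K::real. K > 0 \<and>
    (\<forall>(\<sigma>::nat) (N::nat) (D :: nat list list \<Rightarrow> bool list).
       \<sigma> \<ge> 2 \<longrightarrow> N \<ge> 2 \<longrightarrow> (\<exists>m. admissible c \<sigma> N m) \<longrightarrow>
       supports_prefix_special_rank c \<sigma> N D \<longrightarrow>
       real (worst_case_space c \<sigma> N D) \<ge> K * (real N * log 2 (real \<sigma>)))"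
proof -
  \<comment> \<open>Chosen so that B^(c/2) = 2; hence m^(c/2) \<ge> 2 for all m \<ge> B.\<close>
  define B where "B = 4 powr (1 / c)"
  \<comment> \<open>For m \<ge> B, 256 = 4 * 16 * 4 collects the losses of
    \<open>largest_admissible\<close>, of \<open>worst_case_space_ge\<close> and of log A \<ge> (c /
    4) * log m. For m < B, 4 * m * log m is at most 8 * B / c.\<close>
  define K where "K = min (c / 256) (c / (8 * B))"
  have "B > 0" "K > 0"
    using assms by (simp_all add: B_def K_def)
  have "K * (N * log 2 \<sigma>) \<le> worst_case_space c \<sigma> N D"
    if \<sigma>: "\<sigma> \<ge> 2" and ex: "\<exists>m. admissible c \<sigma> N m" and D: "supports_prefix_special_rank c \<sigma> N D"
    for \<sigma> N :: nat and D
  proof -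
    let ?L = "worst_case_space c \<sigma> N D"
    obtain m where adm: "admissible c \<sigma> N m" and N: "N * log 2 \<sigma> \<le> 4 * (m * log 2 m)"
      using largest_admissible[OF assms \<sigma> ex] .
    have m: "m \<ge> 2" "string_length c \<sigma> m \<ge> 1"
      using adm by (auto simp: admissible_def)
    have "K * (4 * (m * log 2 m)) \<le> ?L"
    proof (cases "m < B")
      case True
      have "log 2 m \<le> log 2 B"
        using True m by simp
      also have "\<dots> = 2 / c"
        using log_pow_cancel[of "2::real" 2] by (simp add: B_def log_powr)
      finally have "K * (4 * (m * log 2 m)) \<le> c / (8 * B) * (4 * (B * (2 / c)))"
        using True m \<open>K > 0\<close> assms by (intro mult_mono) (auto simp: K_def)
      also have "\<dots> = 1"
        using assms \<open>B > 0\<close> by simp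
      also have "1 \<le> real ?L"
        using worst_case_space_pos[OF \<sigma> adm D] by simp
      finally show ?thesis .
    next
      case False
      define x where "x = real m powr (c / 2)"
      \<comment> \<open>The exponent c / 2 serves twice: it keeps \<open>A\<close> below the number
        of available strings, and A^2 at most m^c \<le> m.\<close>
      define A where "A = nat \<lfloor>x\<rfloor>"
      have "2 = B powr (c / 2)"
        using assms powr_half_sqrt[of 4] by (simp add: B_def powr_powr)
      also have "\<dots> \<le> x"
        using False \<open>B > 0\<close> assms unfolding x_def by (intro powr_mono2) auto
      finally have "x \<ge> 2" .
      then have A: "0 < A" "real A \<le> x" "sqrt x \<le> real A"
        using sqrt_le_floor[of x] unfolding A_def by linarith+
      have "real A < real \<sigma> ^ string_length c \<sigma> m"
        using A(2) string_length_gt[OF \<sigma> m] unfolding x_def by linarith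
      then have A_le: "A \<le> \<sigma> ^ string_length c \<sigma> m"
        by (metis less_imp_le of_nat_less_iff of_nat_power)
      have "real A * real A \<le> x * x"
        using A(2) by (intro mult_mono) auto
      also have "\<dots> = real m powr c"
        by (simp add: x_def flip: powr_add)
      also have "\<dots> \<le> real m"
        using assms m powr_mono[of c 1 "real m"] by simp
      finally have A_sq: "A * A \<le> m"
        by (metis of_nat_le_iff of_nat_mult)
      have "sqrt x = real m powr (c / 4)"
        by (simp add: x_def powr_powr flip: powr_half_sqrt)
      then have "c / 4 * log 2 m = log 2 (sqrt x)"
        using m by (simp add: log_powr)
      also have "\<dots> \<le> log 2 A"
        using A \<open>x \<ge> 2\<close> by simp
      finally have "m * (c / 4 * log 2 m) \<le> real m * log 2 A"
        by (intro mult_left_mono) auto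
      also have "\<dots> \<le> 16 * ?L"
        using worst_case_space_ge[OF adm D \<sigma> A(1) A_le A_sq] .
      finally have "c / 256 * (4 * (m * log 2 m)) \<le> ?L"
        by (simp add: algebra_simps)
      moreover have "K * (4 * (m * log 2 m)) \<le> c / 256 * (4 * (m * log 2 m))"
        using m by (intro mult_right_mono) (auto simp: K_def)
      ultimately show ?thesis
        by linarith
    qed
    moreover have "K * (N * log 2 \<sigma>) \<le> K * (4 * (m * log 2 m))"
      using N \<open>K > 0\<close> by (intro mult_left_mono) auto
    ultimately show ?thesis
      by linarith
  qed
  then show ?thesis
    using \<open>K > 0\<close> by blast
qed

end
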